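(* Let $G$ be a graph, let $S \subseteq V(G)$, and let $k,\ell$ be positive integers with $\ell \geq 2$. If there are no $k$ pairwise vertex-disjoint $S$-rooted models of $P_\ell$ in $G$, then there is a set $X \subseteq V(G)$ with $|X| \leq (\ell^2-1)(k-1)$ such that there is no $S$-rooted model of $P_\ell$ in $G-X$.
   Context: All graphs are finite, simple and undirected. $P_\ell$ denotes the path on $\ell$ vertices. A model of a graph $H$ in a graph $G$ is a family $(B_x \mid x\in V(H))$ of pairwise disjoint nonempty subsets of $V(G)$, called branch sets, each inducing a connected subgraph of $G$, such that for every $xy\in E(H)$ there is an edge of $G$ with one endpoint in $B_x$ and one endpoint in $B_y$. Given a set $S$ of vertices, the model is $S$-rooted if every branch set contains a vertex of $S$ ($S$ may contain vertices not in the graph under consideration; so an $S$-rooted model in $G-X$ is an $(S\setminus X)$-rooted model in $G-X$). Models are vertex-disjoint if the unions of their branch sets are pairwise disjoint. $G-X$ is the graph obtained from $G$ by deleting the vertices in $X$. *)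

theory Defs
  imports "Graph_Theory.Graph_Theory" "HOL-Library.Disjoint_Sets"
begin

text \<open>
  A finite simple undirected graph is a digraph satisfying \<^locale>\<open>graph\<close>: finite, without loops or
  parallel arcs, and with a symmetric adjacency relation, so that each edge is represented by its
  two orientations.
\<close>

definition path_graph :: "nat \<Rightarrow> nat pair_pre_digraph" where
  "path_graph l = \<lparr> pverts = {..<l},
     parcs = {(i, j). i < l \<and> j < l \<and> (j = Suc i \<or> i = Suc j)} \<rparr>"

lemma pair_graph_path_graph: "pair_graph (path_graph l)"
proof
  show "finite (parcs (path_graph l))"
    by (rule finite_subset[of _ "{..<l} \<times> {..<l}"]) (auto simp: path_graph_def)
qed (auto simp: path_graph_def symmetric_def sym_def)

definition delete_verts :: "('a, 'b) pre_digraph \<Rightarrow> 'a set \<Rightarrow> ('a, 'b) pre_digraph" where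
  "delete_verts G X = G \<restriction> (verts G - X)"

text \<open>
  Only the values of \<open>B\<close> on the vertices of \<open>H\<close> are branch sets; its other values are irrelevant.
\<close>

definition is_model :: "('h, 'c) pre_digraph \<Rightarrow> ('a, 'b) pre_digraph \<Rightarrow> ('h \<Rightarrow> 'a set) \<Rightarrow> bool" where
  "is_model H G B \<longleftrightarrow>
     (\<forall>x\<in>verts H. B x \<noteq> {} \<and> B x \<subseteq> verts G \<and> connected (G \<restriction> B x)) \<and>
     disjoint_family_on B (verts H) \<and>
     (\<forall>x y. x \<rightarrow>\<^bsub>H\<^esub> y \<longrightarrow> (\<exists>u\<in>B x. \<exists>v\<in>B y. u \<rightarrow>\<^bsub>G\<^esub> v))"

definition is_rooted_model ::
    "'a set \<Rightarrow> ('h, 'c) pre_digraph \<Rightarrow> ('a, 'b) pre_digraph \<Rightarrow> ('h \<Rightarrow> 'a set) \<Rightarrow> bool" where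
  "is_rooted_model S H G B \<longleftrightarrow> is_model H G B \<and> (\<forall>x\<in>verts H. B x \<inter> S \<noteq> {})"

definition model_verts :: "('h, 'c) pre_digraph \<Rightarrow> ('h \<Rightarrow> 'a set) \<Rightarrow> 'a set" where
  "model_verts H B = (\<Union>x\<in>verts H. B x)"

definition has_disjoint_rooted_models ::
    "nat \<Rightarrow> 'a set \<Rightarrow> ('h, 'c) pre_digraph \<Rightarrow> ('a, 'b) pre_digraph \<Rightarrow> bool" where
  "has_disjoint_rooted_models k S H G \<longleftrightarrow>
     (\<exists>M. (\<forall>i<k. is_rooted_model S H G (M i)) \<and>
          disjoint_family_on (\<lambda>i. model_verts H (M i)) {..<k})"

end

theory Submission
  imports Defs
begin

text \<open>
  The vertex sets of the rooted models are connected, and no \<open>k\<close> of them are disjoint, so a depth-first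
  search yields at most \<open>k - 1\<close> disjoint paths that together meet all of them. Let \<open>A\<close> be the set of
  vertices on these paths. By Menger's theorem, either some set \<open>X\<close> of at most \<open>(2l - 1)(k - 1)\<close> vertices
  separates \<open>A\<close> from \<open>S\<close>, or there are more disjoint paths from \<open>A\<close> to \<open>S\<close>. In the first case \<open>X\<close> hits
  every rooted model, since each is connected and meets both \<open>A\<close> and \<open>S\<close>. In the second case, cut each
  covering path into segments from which \<open>l\<close> paths to \<open>S\<close> start, losing at most \<open>l - 1\<close> of these on each
  covering path; every segment carries a rooted model of the path on \<open>l\<close> vertices, and there are at
  least \<open>k\<close> segments. Finally \<open>2l - 1 \<le> l\<^sup>2 - 1\<close> because \<open>l \<ge> 2\<close>.
\<close>

section \<open>Menger's theorem\<close>

text \<open>Vertices may repeat and \<open>E\<close> may be any relation, so Menger's theorem is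
  proved here in its directed version and its induction can remove one ordered pair at a time.
  One-element lists are walks, so a separator has to contain \<open>A \<inter> B\<close>.\<close>

definition is_walk :: "('v \<times> 'v) set \<Rightarrow> 'v set \<Rightarrow> 'v set \<Rightarrow> 'v list \<Rightarrow> bool" where
  "is_walk E A B w \<longleftrightarrow> w \<noteq> [] \<and> hd w \<in> A \<and> last w \<in> B \<and> successively (\<lambda>x y. (x, y) \<in> E) w"

definition separates :: "('v \<times> 'v) set \<Rightarrow> 'v set \<Rightarrow> 'v set \<Rightarrow> 'v set \<Rightarrow> bool" where
  "separates E A B X \<longleftrightarrow> (\<forall>w. is_walk E A B w \<longrightarrow> set w \<inter> X \<noteq> {})"

definition has_linkage :: "('v \<times> 'v) set \<Rightarrow> 'v set \<Rightarrow> 'v set \<Rightarrow> nat \<Rightarrow> bool" where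
  "has_linkage E A B n \<longleftrightarrow>
     (\<exists>P. finite P \<and> card P = n \<and> (\<forall>w\<in>P. is_walk E A B w) \<and> disjoint_family_on set P)"

lemma is_walk_rev: "is_walk (E\<inverse>) B A (rev w) \<longleftrightarrow> is_walk E A B w"
  by (auto simp: is_walk_def hd_rev last_rev)

lemma has_linkage_converse:
  assumes "has_linkage E A B n" shows "has_linkage (E\<inverse>) B A n"
proof -
  obtain P where P: "finite P" "card P = n" "\<forall>w\<in>P. is_walk E A B w" "disjoint_family_on set P"
    using assms by (auto simp: has_linkage_def)
  have "card (rev ` P) = n"
    using P by (simp add: card_image)
  then show ?thesis
    unfolding has_linkage_def using P
    by (intro exI[of _ "rev ` P"]) (auto simp: is_walk_rev disjoint_family_on_def)
qed

lemma walk_first_hit: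
  assumes "is_walk E A B w" "set w \<inter> T \<noteq> {}"
  obtains u t v where "w = u @ t # v" "is_walk E A {t} (u @ [t])" "t \<in> T" "set u \<inter> T = {}"
proof -
  obtain u t v where "w = u @ t # v" "t \<in> T" "\<forall>y\<in>set u. y \<notin> T"
    using split_list_first_prop[of w "\<lambda>y. y \<in> T"] assms(2) by blast
  moreover then have "is_walk E A {t} (u @ [t])"
    using assms(1) by (auto simp: is_walk_def successively_append_iff hd_append split: if_splits)
  ultimately show ?thesis using that by blast
qed

lemma walk_last_hit:
  assumes "is_walk E A B w" "set w \<inter> T \<noteq> {}"
  obtains u t v where "w = u @ t # v" "is_walk E {t} B (t # v)" "t \<in> T" "set v \<inter> T = {}"
proof -
  obtain u t v where *: "rev w = u @ t # v" "is_walk (E\<inverse>) B {t} (u @ [t])" "t \<in> T" "set u \<inter> T = {}"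
    by (rule walk_first_hit[of "E\<inverse>" B A "rev w" T]) (use assms in \<open>auto simp: is_walk_rev\<close>)
  have "w = rev v @ t # rev u" using *(1) by (metis append.assoc append_Cons append_Nil rev.simps(2) rev_append rev_rev_ident)
  moreover have "is_walk E {t} B (t # rev u)"
    using *(2) is_walk_rev[of E B "{t}" "t # rev u"] by simp
  ultimately show ?thesis using that[of "rev v" t "rev u"] *(3,4) by auto
qed

text \<open>Each walk is cut at its first vertex in \<open>T\<close>. Disjointness makes the
  resulting ends distinct, so the cut walks can be indexed by them. If \<open>T\<close> is finite
  with exactly \<open>n\<close> elements, each of these becomes an end.\<close>

lemma linkage_trim_end:
  assumes "has_linkage E A T n"
  obtains T' c where "T' \<subseteq> T" "card T' = n"
    "\<forall>t\<in>T'. is_walk E A {t} (c t @ [t])" "\<forall>t\<in>T'. set (c t) \<inter> T = {}"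
    "disjoint_family_on (\<lambda>t. set (c t @ [t])) T'"
proof -
  obtain P where P: "finite P" "card P = n" "\<forall>w\<in>P. is_walk E A T w" "disjoint_family_on set P"
    using assms by (auto simp: has_linkage_def)
  have "\<exists>u t. is_walk E A {t} (u @ [t]) \<and> t \<in> T \<and> set u \<inter> T = {} \<and> set (u @ [t]) \<subseteq> set w"
    if "w \<in> P" for w
  proof -
    have "is_walk E A T w" using P that by blast
    moreover then have "set w \<inter> T \<noteq> {}" by (auto simp: is_walk_def) (metis disjoint_iff last_in_set)
    ultimately show ?thesis by (rule walk_first_hit) fastforce
  qed
  then obtain u t where ut: "\<And>w. w \<in> P \<Longrightarrow> is_walk E A {t w} (u w @ [t w]) \<and> t w \<in> T
      \<and> set (u w) \<inter> T = {} \<and> set (u w @ [t w]) \<subseteq> set w"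
    by metis
  have inj: "inj_on t P"
  proof (rule inj_onI)
    fix v w assume *: "v \<in> P" "w \<in> P" "t v = t w"
    then have "t v \<in> set v \<inter> set w" using ut[of v] ut[of w] by auto
    then show "v = w" using P(4) * by (auto simp: disjoint_family_on_def)
  qed
  define c where "c = (\<lambda>x. u (inv_into P t x))"
  have c: "c (t w) = u w" if "w \<in> P" for w using inj that by (simp add: c_def)
  show ?thesis
  proof (rule that[of "t ` P" c])
    show "disjoint_family_on (\<lambda>x. set (c x @ [x])) (t ` P)"
      unfolding disjoint_family_on_def
    proof (intro ballI impI)
      fix x y assume "x \<in> t ` P" "y \<in> t ` P" "x \<noteq> y"
      then obtain v w where *: "v \<in> P" "w \<in> P" "x = t v" "y = t w" "v \<noteq> w" by auto
      then have "set v \<inter> set w = {}" using P(4) by (auto simp: disjoint_family_on_def)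
      moreover have "set (c x @ [x]) \<subseteq> set v" "set (c y @ [y]) \<subseteq> set w"
        using ut[of v] ut[of w] * c[of v] c[of w] by simp_all
      ultimately show "set (c x @ [x]) \<inter> set (c y @ [y]) = {}" by blast
    qed
    show "\<forall>x\<in>t ` P. set (c x) \<inter> T = {}" using ut c by simp
  qed (use ut c inj P in \<open>auto simp: card_image\<close>)
qed

lemma linkage_trim_start:
  assumes "has_linkage E T B n"
  obtains T' d where "T' \<subseteq> T" "card T' = n"
    "\<forall>t\<in>T'. is_walk E {t} B (t # d t)" "\<forall>t\<in>T'. set (d t) \<inter> T = {}"
    "disjoint_family_on (\<lambda>t. set (t # d t)) T'"
proof -
  obtain T' c where *: "T' \<subseteq> T" "card T' = n"
    "\<forall>t\<in>T'. is_walk (E\<inverse>) B {t} (c t @ [t])" "\<forall>t\<in>T'. set (c t) \<inter> T = {}"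
    "disjoint_family_on (\<lambda>t. set (c t @ [t])) T'"
    using linkage_trim_end[OF has_linkage_converse[OF assms]] by blast
  show ?thesis
  proof (rule that[of T' "\<lambda>t. rev (c t)"])
    show "\<forall>t\<in>T'. is_walk E {t} B (t # rev (c t))"
    proof
      fix t assume "t \<in> T'"
      then show "is_walk E {t} B (t # rev (c t))"
        using *(3) is_walk_rev[of E B "{t}" "t # rev (c t)"] by simp
    qed
  qed (use * in auto)
qed

lemma is_walk_mono: "is_walk E A B w \<Longrightarrow> E \<subseteq> E' \<Longrightarrow> is_walk E' A B w"
  by (auto simp: is_walk_def elim: successively_mono)

lemma is_walk_append:
  assumes "is_walk E A B u" "is_walk E C D v" "(last u, hd v) \<in> E"
  shows "is_walk E A D (u @ v)"
  using assms by (auto simp: is_walk_def successively_append_iff)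

lemma is_walk_join:
  assumes "is_walk E A B (u @ [t])" "is_walk E C D (t # v)"
  shows "is_walk E A D (u @ t # v)"
  using assms by (auto simp: is_walk_def successively_append_iff hd_append)

text \<open>A step from \<open>x\<close> to \<open>y\<close> would put \<open>x\<close> at a
  position other than the last and \<open>y\<close> at one other than the first.\<close>

lemma successively_insert_edge:
  assumes "successively (\<lambda>a b. (a, b) \<in> insert (x, y) E) w" "x \<notin> set (butlast w) \<or> y \<notin> set (tl w)"
  shows "successively (\<lambda>a b. (a, b) \<in> E) w"
  using assms
proof (induction w rule: induct_list012)
  case (3 a b w)
  then show ?case by (cases w) auto
qed auto

text \<open>
  Goering's argument: when deleting an edge \<open>(x, y)\<close> creates a separator \<open>Z\<close> that is too small, it is
  smaller by exactly one, and linkages from \<open>A\<close> to \<open>insert x Z\<close> and from \<open>insert y Z\<close> to \<open>B\<close> fit together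
  along \<open>Z\<close> and \<open>(x, y)\<close>.
\<close>

theorem menger:
  assumes "finite E" "finite A" "finite B"
    and "\<And>X. finite X \<Longrightarrow> separates E A B X \<Longrightarrow> n \<le> card X"
  shows "has_linkage E A B n"
  using assms
proof (induction E arbitrary: A B rule: finite_induct)
  case empty
  \<comment> \<open>Without edges every walk is a single vertex, so \<open>A \<inter> B\<close>
    separates, and its elements provide the linkage.\<close>
  have "separates {} A B (A \<inter> B)"
    unfolding separates_def
  proof (intro allI impI)
    fix w :: "'a list" assume *: "is_walk {} A B w"
    then obtain a where "w = [a]"
      by (cases w rule: remdups_adj.cases) (auto simp: is_walk_def)
    then show "set w \<inter> (A \<inter> B) \<noteq> {}" using * by (auto simp: is_walk_def)
  qed
  then have "n \<le> card (A \<inter> B)" using empty by auto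
  then obtain T where T: "T \<subseteq> A \<inter> B" "card T = n" "finite T" by (rule obtain_subset_with_card_n)
  have "card ((\<lambda>a. [a]) ` T) = n" using T by (simp add: card_image inj_on_def)
  then show ?case unfolding has_linkage_def using T
    by (intro exI[of _ "(\<lambda>a. [a]) ` T"]) (auto simp: is_walk_def disjoint_family_on_def)
next
  case (insert e E)
  obtain x y where e: "e = (x, y)" by fastforce
  show ?case
  proof (cases "\<forall>X. finite X \<longrightarrow> separates E A B X \<longrightarrow> n \<le> card X")
    case True
    then have "has_linkage E A B n" using insert.IH insert.prems by blast
    then show ?thesis unfolding has_linkage_def using is_walk_mono[OF _ subset_insertI] by metis
  next
    case False
    then obtain Z where Z: "finite Z" "separates E A B Z" "card Z < n" by force
    \<comment> \<open>A walk that misses \<open>Z\<close> is not a walk in \<open>E\<close>, so it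
      uses the new edge and contains both ends of it. Hence adding either end to \<open>Z\<close>
      gives a separator for the full relation.\<close>
    have hits: "set w \<inter> Z \<noteq> {} \<or> (x \<in> set w \<and> y \<in> set w)" if "is_walk (insert e E) A B w" for w
    proof (rule ccontr)
      assume *: "\<not> ?thesis"
      then have "x \<notin> set (butlast w) \<or> y \<notin> set (tl w)"
        by (cases w) (auto dest: in_set_butlastD)
      then have "is_walk E A B w"
        using that successively_insert_edge[of x y E w] by (auto simp: is_walk_def e)
      then show False using Z(2) * by (auto simp: separates_def)
    qed
    then have "separates (insert e E) A B (insert x Z)" "separates (insert e E) A B (insert y Z)"
      unfolding separates_def by (meson disjoint_iff insertCI)+
    then have "n \<le> card (insert x Z)" "n \<le> card (insert y Z)"
      using insert.prems Z by (meson finite_insert)+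
    \<comment> \<open>Since \<open>card Z < n\<close>, one more vertex brings the size up to
      \<open>n\<close> only if it is new and \<open>Z\<close> has exactly \<open>n - 1\<close>
      elements.\<close>
    then have xy: "x \<notin> Z" "y \<notin> Z" and cards: "card (insert x Z) = n" "card (insert y Z) = n"
      using Z by (auto simp: card_insert_if split: if_splits)
    have "has_linkage E A (insert x Z) n"
    proof (rule insert.IH)
      fix Y assume Y: "finite Y" "separates E A (insert x Z) Y"
      \<comment> \<open>Up to its first vertex in \<open>insert x Z\<close>, a walk has
        \<open>x\<close> at most at its end and cannot use the edge \<open>(x, y)\<close>. This
        initial part is therefore a walk in \<open>E\<close> and meets \<open>Y\<close>.\<close>
      have "separates (insert e E) A B Y"
        unfolding separates_def
      proof (intro allI impI)
        fix w assume w: "is_walk (insert e E) A B w"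
        have "set w \<inter> insert x Z \<noteq> {}" using hits[OF w] by auto
        with w obtain u t v where *: "w = u @ t # v" "is_walk (insert e E) A {t} (u @ [t])" "t \<in> insert x Z" "set u \<inter> insert x Z = {}"
          by (rule walk_first_hit)
        then have "is_walk E A (insert x Z) (u @ [t])"
          using successively_insert_edge[of x y E "u @ [t]"] by (auto simp: is_walk_def e)
        then show "set w \<inter> Y \<noteq> {}" using Y *(1) by (fastforce simp: separates_def)
      qed
      then show "n \<le> card Y" using insert.prems Y by blast
    qed (use insert.prems Z in auto)
    then obtain T c where Tc: "T \<subseteq> insert x Z" "card T = n"
      "\<forall>t\<in>T. is_walk E A {t} (c t @ [t])" "\<forall>t\<in>T. set (c t) \<inter> insert x Z = {}"
      "disjoint_family_on (\<lambda>t. set (c t @ [t])) T"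
      by (rule linkage_trim_end)
    have T: "T = insert x Z" using Tc(1,2) cards Z by (simp add: card_subset_eq)
    note c = Tc(3)[unfolded T, rule_format] Tc(4)[unfolded T, rule_format] Tc(5)[unfolded T]
    have "has_linkage E (insert y Z) B n"
    proof (rule insert.IH)
      fix Y assume Y: "finite Y" "separates E (insert y Z) B Y"
      \<comment> \<open>From its last vertex in \<open>insert y Z\<close> on, a walk has
        \<open>y\<close> at most at its start, so this part does not use the new edge
        either.\<close>
      have "separates (insert e E) A B Y"
        unfolding separates_def
      proof (intro allI impI)
        fix w assume w: "is_walk (insert e E) A B w"
        have "set w \<inter> insert y Z \<noteq> {}" using hits[OF w] by auto
        with w obtain u t v where *: "w = u @ t # v" "is_walk (insert e E) {t} B (t # v)" "t \<in> insert y Z" "set v \<inter> insert y Z = {}"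
          by (rule walk_last_hit)
        then have "is_walk E (insert y Z) B (t # v)"
          using successively_insert_edge[of x y E "t # v"] by (auto simp: is_walk_def e)
        then show "set w \<inter> Y \<noteq> {}" using Y *(1) by (fastforce simp: separates_def)
      qed
      then show "n \<le> card Y" using insert.prems Y by blast
    qed (use insert.prems Z in auto)
    then obtain T' d where Td: "T' \<subseteq> insert y Z" "card T' = n"
      "\<forall>t\<in>T'. is_walk E {t} B (t # d t)" "\<forall>t\<in>T'. set (d t) \<inter> insert y Z = {}"
      "disjoint_family_on (\<lambda>t. set (t # d t)) T'"
      by (rule linkage_trim_start)
    have T': "T' = insert y Z" using Td(1,2) cards Z by (simp add: card_subset_eq)
    note d = Td(3)[unfolded T', rule_format] Td(4)[unfolded T', rule_format] Td(5)[unfolded T']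
    \<comment> \<open>An initial and a final walk sharing \<open>v\<close> can be spliced there to a
      walk in \<open>E\<close> from \<open>A\<close> to \<open>B\<close>, which must meet
      \<open>Z\<close>. Before \<open>v\<close> the initial walk avoids \<open>Z\<close>, and after
      \<open>v\<close> the final one does, so \<open>v\<close> itself lies in \<open>Z\<close> and
      is the point where both are attached to \<open>Z\<close>.\<close>
    have cross: "v = s \<and> v = t \<and> v \<in> Z"
      if st: "s \<in> insert x Z" "t \<in> insert y Z" and v: "v \<in> set (c s @ [s])" "v \<in> set (t # d t)" for s t v
    proof -
      obtain u u' where u: "c s @ [s] = u @ v # u'" using v(1) by (meson split_list)
      obtain z z' where z: "t # d t = z @ v # z'" using v(2) by (meson split_list)
      have "is_walk E A {v} (u @ [v])"
        using c(1)[OF st(1)] u by (auto simp: is_walk_def successively_append_iff hd_append split: if_splits)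
      moreover have "is_walk E {v} B (v # z')"
        using d(1)[OF st(2)] z by (auto simp: is_walk_def successively_append_iff)
      ultimately have "is_walk E A B (u @ v # z')" by (rule is_walk_join)
      then obtain a where a: "a \<in> Z" "a \<in> set (u @ v # z')" using Z(2) unfolding separates_def by blast
      have "set u \<subseteq> set (c s)"
        using u by (metis butlast_append butlast_snoc list.distinct(1) set_append sup_ge1)
      moreover have "set z' \<subseteq> set (d t)" using z by (cases z) auto
      ultimately have "a = v" using a c(2)[OF st(1)] d(2)[OF st(2)] by auto
      then show ?thesis using v a(1) c(2)[OF st(1)] d(2)[OF st(2)] by auto
    qed
    \<comment> \<open>The walk ending in \<open>x\<close> crosses the new edge to \<open>y\<close>;
      every other one continues from the same vertex of \<open>Z\<close>.\<close>
    define f where "f s = (if s = x then c x @ [x] @ y # d y else c s @ s # d s)" for s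
    have walk: "is_walk (insert e E) A B (f s)" if "s \<in> insert x Z" for s
    proof (cases "s = x")
      case True
      have "is_walk (insert e E) A B ((c x @ [x]) @ y # d y)"
        by (rule is_walk_append[of _ A "{x}" _ "{y}"]) (use c(1)[of x] d(1)[of y] in \<open>auto simp: e intro: is_walk_mono\<close>)
      then show ?thesis using True by (simp add: f_def)
    next
      case False
      have "is_walk E A B (c s @ s # d s)"
        by (rule is_walk_join[of _ A "{s}" _ _ "{s}"]) (use False that c(1) d(1) in auto)
      then show ?thesis using False by (auto simp: f_def intro: is_walk_mono)
    qed
    \<comment> \<open>\<open>g s\<close> is the start of the final walk used by \<open>f s\<close>;
      it is injective on \<open>insert x Z\<close> because \<open>y \<notin> Z\<close>.\<close>
    define g where "g s = (if s = x then y else s)" for s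
    have fset: "set (f s) = set (c s @ [s]) \<union> set (g s # d (g s))" for s by (auto simp: f_def g_def)
    have g: "g s \<in> insert y Z" "s \<in> insert x Z \<Longrightarrow> t \<in> insert x Z \<Longrightarrow> g s = g t \<Longrightarrow> s = t"
      if "s \<in> insert x Z" for s t using that xy by (auto simp: g_def split: if_splits)
    have disj: "set (f s) \<inter> set (f t) = {}" if st: "s \<in> insert x Z" "t \<in> insert x Z" "s \<noteq> t" for s t
    proof -
      have cc: "set (c s @ [s]) \<inter> set (c t @ [t]) = {}"
        by (rule disjoint_family_onD[OF c(3) st])
      have "g s \<noteq> g t" using g(2)[OF st(1)] st by blast
      then have dd: "set (g s # d (g s)) \<inter> set (g t # d (g t)) = {}"
        by (rule disjoint_family_onD[OF d(3) g(1)[OF st(1)] g(1)[OF st(2)]])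
      have cd: "set (c s @ [s]) \<inter> set (g t # d (g t)) = {}" if "s \<in> insert x Z" "t \<in> insert x Z" "s \<noteq> t" for s t
      proof (rule Int_emptyI)
        fix a assume "a \<in> set (c s @ [s])" "a \<in> set (g t # d (g t))"
        then have "a = s \<and> a = g t \<and> a \<in> Z" by (rule cross[OF that(1) g(1)[OF that(2)]])
        then show False using that(3) xy by (auto simp: g_def split: if_splits)
      qed
      have dc: "set (g s # d (g s)) \<inter> set (c t @ [t]) = {}"
        by (subst Int_commute) (rule cd[OF st(2,1) not_sym[OF st(3)]])
      show ?thesis
        by (simp only: fset Int_Un_distrib Int_Un_distrib2 cc dd dc cd[OF st] Un_empty_left)
    qed
    have ne: "f s \<noteq> []" for s by (simp add: f_def)
    have "inj_on f (insert x Z)"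
      by (rule inj_onI) (metis disj ne inf.idem set_empty)
    then have "card (f ` insert x Z) = n" using cards(1) card_image by metis
    moreover have "disjoint_family_on set (f ` insert x Z)"
      unfolding disjoint_family_on_def
    proof (intro ballI impI)
      fix v w assume "v \<in> f ` insert x Z" "w \<in> f ` insert x Z" "v \<noteq> w"
      then obtain s t where "s \<in> insert x Z" "t \<in> insert x Z" "s \<noteq> t" "v = f s" "w = f t" by blast
      then show "set v \<inter> set w = {}" using disj by simp
    qed
    ultimately show ?thesis
      unfolding has_linkage_def using Z walk by (intro exI[of _ "f ` insert x Z"]) auto
  qed
qed

section \<open>Packing and covering connected sets\<close>

text \<open>For symmetric \<open>E\<close> this is connectedness of the subgraph induced on
  \<open>M\<close>, except that the empty set counts as connected.\<close>

definition conn_in :: "('v \<times> 'v) set \<Rightarrow> 'v set \<Rightarrow> bool" where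
  "conn_in E M \<longleftrightarrow> (\<forall>a\<in>M. \<forall>b\<in>M. (a, b) \<in> (E \<inter> M \<times> M)\<^sup>*)"

text \<open>For finite \<open>\<M>\<close> the maximum is over a finite set of cardinalities that
  contains 0, coming from the empty family.\<close>

definition packing_number :: "'v set set \<Rightarrow> 'v set \<Rightarrow> nat" where
  "packing_number \<M> U = Max (card ` {\<F>. \<F> \<subseteq> \<M> \<and> \<Union>\<F> \<subseteq> U \<and> disjoint \<F>})"

lemma packing_number_ge:
  assumes "finite \<M>" "\<F> \<subseteq> \<M>" "\<Union>\<F> \<subseteq> U" "disjoint \<F>"
  shows "card \<F> \<le> packing_number \<M> U"
  unfolding packing_number_def using assms
  by (intro Max_ge finite_imageI) (auto intro: finite_subset[of _ "Pow \<M>"])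

lemma packing_number_attained:
  assumes "finite \<M>"
  obtains \<F> where "\<F> \<subseteq> \<M>" "\<Union>\<F> \<subseteq> U" "disjoint \<F>" "card \<F> = packing_number \<M> U"
proof -
  let ?C = "{\<F>. \<F> \<subseteq> \<M> \<and> \<Union>\<F> \<subseteq> U \<and> disjoint \<F>}"
  have "{} \<in> ?C" by (simp add: disjoint_def)
  moreover have "finite ?C" using assms by (auto intro: finite_subset[of _ "Pow \<M>"])
  ultimately have "packing_number \<M> U \<in> card ` ?C"
    unfolding packing_number_def by (intro Max_in) auto
  then show ?thesis using that by auto
qed

text \<open>Packings inside disjoint sets unite to a packing. An empty member could belong to both
  and would then be counted only once.\<close>

lemma packing_number_add:
  assumes "finite \<M>" "{} \<notin> \<M>" "U \<inter> W = {}"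
  shows "packing_number \<M> U + packing_number \<M> W \<le> packing_number \<M> (U \<union> W)"
proof -
  obtain \<F> where F: "\<F> \<subseteq> \<M>" "\<Union>\<F> \<subseteq> U" "disjoint \<F>" "card \<F> = packing_number \<M> U"
    using packing_number_attained assms(1) by blast
  obtain \<G> where G: "\<G> \<subseteq> \<M>" "\<Union>\<G> \<subseteq> W" "disjoint \<G>" "card \<G> = packing_number \<M> W"
    using packing_number_attained assms(1) by blast
  have "X = {}" if "X \<in> \<F>" "X \<in> \<G>" for X
    using F(2) G(2) assms(3) that by blast
  then have "\<F> \<inter> \<G> = {}" using F(1) assms(2) by blast
  then have "card (\<F> \<union> \<G>) = packing_number \<M> U + packing_number \<M> W"
    using F G assms by (metis card_Un_disjoint finite_subset)
  moreover have "card (\<F> \<union> \<G>) \<le> packing_number \<M> (U \<union> W)"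
  proof (rule packing_number_ge)
    show "disjoint (\<F> \<union> \<G>)" using F(2,3) G(2,3) assms(3) by (intro disjoint_union) blast+
  qed (use F G assms in auto)
  ultimately show ?thesis by simp
qed

lemma packing_number_mono:
  assumes "finite \<M>" "U \<subseteq> W"
  shows "packing_number \<M> U \<le> packing_number \<M> W"
proof -
  obtain \<F> where "\<F> \<subseteq> \<M>" "\<Union>\<F> \<subseteq> U" "disjoint \<F>" "card \<F> = packing_number \<M> U"
    using packing_number_attained assms(1) by blast
  then show ?thesis using packing_number_ge[of \<M> \<F> W] assms by auto
qed

lemma packing_number_pos:
  assumes "finite \<M>" "M \<in> \<M>" "M \<subseteq> U"
  shows "1 \<le> packing_number \<M> U"
  using packing_number_ge[of \<M> "{M}" U] assms by (auto simp: disjoint_def)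

text \<open>
  Depth-first search: a path continues into one component of what is left and a new path is started in
  each further component that still contains a member. The set \<open>N\<close> makes the induction work; it
  becomes the neighbourhood of the last vertex of the current path, so that the path found first can
  be appended to it.
\<close>

lemma path_cover:
  assumes "finite U" "finite \<M>" "{} \<notin> \<M>" "\<And>M. M \<in> \<M> \<Longrightarrow> conn_in E M"
    and "\<And>M. M \<in> \<M> \<Longrightarrow> M \<subseteq> U \<Longrightarrow> \<exists>u\<in>N \<inter> U. \<exists>m\<in>M. (u, m) \<in> (E \<inter> U \<times> U)\<^sup>*"
  shows "\<exists>ps. length ps \<le> packing_number \<M> U \<and> distinct (concat ps) \<and> set (concat ps) \<subseteq> U \<and>
    (\<forall>p\<in>set ps. p \<noteq> [] \<and> successively (\<lambda>x y. (x, y) \<in> E) p) \<and>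
    (\<forall>M\<in>\<M>. M \<subseteq> U \<longrightarrow> M \<inter> set (concat ps) \<noteq> {}) \<and>
    (ps \<noteq> [] \<longrightarrow> hd (hd ps) \<in> N)"
  using assms(1,5)
proof (induction "card U" arbitrary: U N rule: less_induct)
  case less
  show ?case
  proof (cases "\<exists>M\<in>\<M>. M \<subseteq> U")
    case False
    then show ?thesis by (intro exI[of _ "[]"]) auto
  next
    case True
    then obtain M0 u m0 where M0: "M0 \<in> \<M>" "M0 \<subseteq> U" "u \<in> N" "u \<in> U" "m0 \<in> M0" "(u, m0) \<in> (E \<inter> U \<times> U)\<^sup>*"
      using less.prems(2) by blast
    \<comment> \<open>\<open>D\<close> plays the role of the component of \<open>u\<close>. Members
      are connected, so each member inside \<open>U\<close> lies either in \<open>D\<close> or in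
      \<open>U - D\<close>, and the two parts can be treated separately.\<close>
    define D where "D = {w\<in>U. (u, w) \<in> (E \<inter> U \<times> U)\<^sup>*}"
    have D: "u \<in> D" "D \<subseteq> U" using M0 by (auto simp: D_def)
    have closed: "w \<in> D" if "v \<in> D" "(v, w) \<in> (E \<inter> U \<times> U)\<^sup>*" for v w
    proof -
      have "w \<in> U" using that(2,1) D by (induction) auto
      then show ?thesis using that by (auto simp: D_def)
    qed
    have inD: "M \<subseteq> D" if "M \<in> \<M>" "M \<subseteq> U" "m \<in> M" "m \<in> D" for M m
    proof
      fix w assume "w \<in> M"
      then have "(m, w) \<in> (E \<inter> M \<times> M)\<^sup>*" using assms(4)[OF that(1)] that(3) by (auto simp: conn_in_def)
      moreover have "(E \<inter> M \<times> M)\<^sup>* \<subseteq> (E \<inter> U \<times> U)\<^sup>*" using that by (intro rtrancl_mono) auto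
      ultimately show "w \<in> D" using closed that(4) by blast
    qed
    have "m0 \<in> D" using M0 by (auto simp: D_def)
    then have M0D: "M0 \<subseteq> D" using inD M0 by blast
    have finD: "finite D" using D less.prems(1) finite_subset by blast
    have "\<exists>ps. length ps \<le> packing_number \<M> (D - {u}) \<and> distinct (concat ps) \<and> set (concat ps) \<subseteq> D - {u} \<and>
      (\<forall>p\<in>set ps. p \<noteq> [] \<and> successively (\<lambda>x y. (x, y) \<in> E) p) \<and>
      (\<forall>M\<in>\<M>. M \<subseteq> D - {u} \<longrightarrow> M \<inter> set (concat ps) \<noteq> {}) \<and>
      (ps \<noteq> [] \<longrightarrow> hd (hd ps) \<in> E `` {u})"
    proof (rule less.hyps)
      show "card (D - {u}) < card U"
        using D M0 less.prems by (intro psubset_card_mono) auto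
      fix M assume M: "M \<in> \<M>" "M \<subseteq> D - {u}"
      then obtain m where m: "m \<in> M" using assms(3) by fastforce
      \<comment> \<open>After its last visit to \<open>u\<close>, a path from \<open>u\<close> to
        another vertex continues at a neighbour of \<open>u\<close> and stays in
        \<open>D - {u}\<close>.\<close>
      have *: "x = u \<or> (\<exists>v\<in>E `` {u} \<inter> (D - {u}). (v, x) \<in> (E \<inter> (D - {u}) \<times> (D - {u}))\<^sup>*)"
        if "(u, x) \<in> (E \<inter> U \<times> U)\<^sup>*" for x
        using that
      proof (induction)
        case (step y z)
        then have yz: "y \<in> D" "z \<in> D" "(y, z) \<in> E"
          using rtrancl.rtrancl_into_rtrancl[OF step(1,2)] by (auto simp: D_def)
        show ?case
        proof (cases "z = u")
          case False
          show ?thesis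
          proof (cases "y = u")
            case True
            then show ?thesis using yz False by blast
          next
            case y: False
            then have "(y, z) \<in> E \<inter> (D - {u}) \<times> (D - {u})" using yz False by blast
            then show ?thesis using step.IH y by (meson rtrancl.rtrancl_into_rtrancl)
          qed
        qed simp
      qed simp
      have "(u, m) \<in> (E \<inter> U \<times> U)\<^sup>*" "m \<noteq> u" using m M by (auto simp: D_def)
      then show "\<exists>v\<in>E `` {u} \<inter> (D - {u}). \<exists>m\<in>M. (v, m) \<in> (E \<inter> (D - {u}) \<times> (D - {u}))\<^sup>*"
        using *[of m] m by blast
    qed (use finD in auto)
    then obtain ps where ps: "length ps \<le> packing_number \<M> (D - {u})" "distinct (concat ps)" "set (concat ps) \<subseteq> D - {u}"
      "\<forall>p\<in>set ps. p \<noteq> [] \<and> successively (\<lambda>x y. (x, y) \<in> E) p"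
      "\<forall>M\<in>\<M>. M \<subseteq> D - {u} \<longrightarrow> M \<inter> set (concat ps) \<noteq> {}"
      "ps \<noteq> [] \<longrightarrow> hd (hd ps) \<in> E `` {u}" by blast
    have "\<exists>ps. length ps \<le> packing_number \<M> (U - D) \<and> distinct (concat ps) \<and> set (concat ps) \<subseteq> U - D \<and>
      (\<forall>p\<in>set ps. p \<noteq> [] \<and> successively (\<lambda>x y. (x, y) \<in> E) p) \<and>
      (\<forall>M\<in>\<M>. M \<subseteq> U - D \<longrightarrow> M \<inter> set (concat ps) \<noteq> {}) \<and>
      (ps \<noteq> [] \<longrightarrow> hd (hd ps) \<in> N)"
    proof (rule less.hyps)
      show "card (U - D) < card U"
        using D M0 less.prems by (intro psubset_card_mono) auto
      fix M assume M: "M \<in> \<M>" "M \<subseteq> U - D"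
      then obtain v m where v: "v \<in> N" "v \<in> U" "m \<in> M" "(v, m) \<in> (E \<inter> U \<times> U)\<^sup>*"
        using less.prems(2)[of M] by blast
      \<comment> \<open>A path in \<open>U\<close> that has entered \<open>D\<close> stays there, so
        one that ends in \<open>M\<close>, outside \<open>D\<close>, runs entirely in
        \<open>U - D\<close>.\<close>
      have "x \<in> D \<or> (v, x) \<in> (E \<inter> (U - D) \<times> (U - D))\<^sup>*" if "(v, x) \<in> (E \<inter> U \<times> U)\<^sup>*" for x
        using that
      proof (induction)
        case (step y z)
        then have "z \<in> D" if "y \<in> D" using closed[of y z] that by blast
        then show ?case using step by (cases "z \<in> D") (auto intro: rtrancl.rtrancl_into_rtrancl)
      qed simp
      moreover have "v \<notin> D" using closed v M by blast
      ultimately show "\<exists>v\<in>N \<inter> (U - D). \<exists>m\<in>M. (v, m) \<in> (E \<inter> (U - D) \<times> (U - D))\<^sup>*"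
        using v M by blast
    qed (use less.prems in auto)
    then obtain qs where qs: "length qs \<le> packing_number \<M> (U - D)" "distinct (concat qs)" "set (concat qs) \<subseteq> U - D"
      "\<forall>p\<in>set qs. p \<noteq> [] \<and> successively (\<lambda>x y. (x, y) \<in> E) p"
      "\<forall>M\<in>\<M>. M \<subseteq> U - D \<longrightarrow> M \<inter> set (concat qs) \<noteq> {}" by blast
    define rs where "rs = (if ps = [] then [[u]] else (u # hd ps) # tl ps)"
    have c: "concat rs = u # concat ps" by (cases ps) (auto simp: rs_def)
    \<comment> \<open>Prepending \<open>u\<close> adds no path unless \<open>ps\<close> is empty; in
      that case the single path \<open>[u]\<close> is paid for by the member \<open>M0\<close>
      inside \<open>D\<close>.\<close>
    have "length rs \<le> packing_number \<M> D"
      using ps(1) packing_number_pos[OF assms(2) M0(1) M0D] packing_number_mono[OF assms(2), of "D - {u}" D]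
      by (cases ps) (auto simp: rs_def)
    moreover have "D \<union> (U - D) = U" using D by auto
    ultimately have r1: "length (rs @ qs) \<le> packing_number \<M> U"
      using qs(1) packing_number_add[OF assms(2,3), of D "U - D"] by auto
    have r2: "distinct (concat (rs @ qs))" using c ps(2,3) qs(2,3) D(1) by auto
    have r3: "set (concat (rs @ qs)) \<subseteq> U" using c ps(3) qs(3) D by auto
    have r4: "\<forall>p\<in>set (rs @ qs). p \<noteq> [] \<and> successively (\<lambda>x y. (x, y) \<in> E) p"
    proof -
      have "\<forall>p\<in>set rs. p \<noteq> [] \<and> successively (\<lambda>x y. (x, y) \<in> E) p"
      proof (cases ps)
        case (Cons p ps')
        then have "successively (\<lambda>x y. (x, y) \<in> E) (u # p)"
          using ps(4,6) by (simp add: successively_Cons)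
        then show ?thesis using Cons ps(4) by (simp add: rs_def)
      qed (simp add: rs_def)
      then show ?thesis using qs(4) by (metis Un_iff set_append)
    qed
    have r5: "M \<inter> set (concat (rs @ qs)) \<noteq> {}" if M: "M \<in> \<M>" "M \<subseteq> U" for M
    proof (cases "M \<inter> D = {}")
      case True
      then have "M \<subseteq> U - D" using M(2) by blast
      then have "M \<inter> set (concat qs) \<noteq> {}" using qs(5) M(1) by simp
      then show ?thesis unfolding concat_append set_append by blast
    next
      case False
      then have "M \<subseteq> D" using inD M by blast
      then have "u \<notin> M \<Longrightarrow> M \<subseteq> D - {u}" by blast
      then have "u \<in> M \<or> M \<inter> set (concat ps) \<noteq> {}" using ps(5) M(1) by metis
      then show ?thesis by (auto simp: c)
    qed
    have r6: "hd (hd (rs @ qs)) \<in> N" using M0 by (simp add: rs_def)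
    show ?thesis
      by (intro exI[of _ "rs @ qs"] conjI ballI impI r1 r2 r3 r5 r6 r4[rule_format, THEN conjunct1]
          r4[rule_format, THEN conjunct2])
  qed
qed

section \<open>Models of paths from linkages\<close>

lemma filter_prefix_of_length:
  "l \<le> length (filter P q) \<Longrightarrow> \<exists>a b. q = a @ b \<and> length (filter P a) = l"
proof (induction q arbitrary: l)
  case (Cons x q)
  show ?case
  proof (cases "l = 0")
    case False
    have "(if P x then l - 1 else l) \<le> length (filter P q)" using Cons.prems by auto
    then obtain a b where "q = a @ b" "length (filter P a) = (if P x then l - 1 else l)"
      using Cons.IH by blast
    then show ?thesis using False by (intro exI[of _ "x # a"] exI[of _ b]) auto
  qed (use append_Nil in fastforce)
qed auto

lemma split_chunks:
  "n * l \<le> length (filter P q) \<Longrightarrow>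
    \<exists>cs rest. q = concat cs @ rest \<and> length cs = n \<and> (\<forall>c\<in>set cs. l \<le> length (filter P c))"
proof (induction n arbitrary: q)
  case (Suc n)
  then obtain a b where ab: "q = a @ b" "length (filter P a) = l"
    using filter_prefix_of_length[of l P q] by auto
  then obtain cs rest where "b = concat cs @ rest" "length cs = n" "\<forall>c\<in>set cs. l \<le> length (filter P c)"
    using Suc.IH[of b] Suc.prems by auto
  then show ?case using ab by (intro exI[of _ "a # cs"] exI[of _ rest]) auto
qed auto

lemma successively_concat_member:
  "successively R (concat cs) \<Longrightarrow> c \<in> set cs \<Longrightarrow> successively R c"
  by (induction cs) (auto simp: successively_append_iff)

lemma successively_concat_adjacent:
  "successively R (concat cs) \<Longrightarrow> [] \<notin> set cs \<Longrightarrow> Suc i < length cs \<Longrightarrow>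
    R (last (cs ! i)) (hd (cs ! Suc i))"
proof (induction cs arbitrary: i)
  case (Cons c cs)
  then obtain d ds where "cs = d # ds" "d \<noteq> []" by (cases cs) auto
  with Cons show ?case by (cases i) (auto simp: successively_append_iff)
qed auto

lemma distinct_concat_nth_disjoint:
  "distinct (concat cs) \<Longrightarrow> i < j \<Longrightarrow> j < length cs \<Longrightarrow> set (cs ! i) \<inter> set (cs ! j) = {}"
proof (induction cs arbitrary: i j)
  case (Cons c cs)
  then obtain j' where j: "j = Suc j'" by (cases j) auto
  show ?case
  proof (cases i)
    case 0
    have "set (cs ! j') \<subseteq> set (concat cs)" using Cons.prems j by auto
    then show ?thesis using Cons.prems(1) j 0 by auto
  next
    case (Suc i')
    then show ?thesis using Cons j by simp
  qed
qed auto

text \<open>Each list is cut separately, so that no chunk straddles two paths; the tail left over in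
  each list is dropped.\<close>

lemma split_all_chunks:
  assumes "distinct (concat ps)" "\<forall>p\<in>set ps. successively R p"
  shows "\<exists>cs. length cs = (\<Sum>p\<leftarrow>ps. length (filter P p) div l) \<and> distinct (concat cs) \<and>
    set (concat cs) \<subseteq> set (concat ps) \<and> (\<forall>c\<in>set cs. successively R c \<and> l \<le> length (filter P c))"
  using assms
proof (induction ps)
  case (Cons p ps)
  then obtain cs where cs: "length cs = (\<Sum>p\<leftarrow>ps. length (filter P p) div l)" "distinct (concat cs)"
    "set (concat cs) \<subseteq> set (concat ps)" "\<forall>c\<in>set cs. successively R c \<and> l \<le> length (filter P c)"
    by auto
  obtain ds rest where ds: "p = concat ds @ rest" "length ds = length (filter P p) div l"
    "\<forall>c\<in>set ds. l \<le> length (filter P c)"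
    using split_chunks[of "length (filter P p) div l" l P p] by auto
  have "successively R (concat ds)" using Cons.prems ds(1) by (simp add: successively_append_iff)
  then have "\<forall>c\<in>set ds. successively R c" using successively_concat_member by blast
  moreover have "distinct (concat (ds @ cs))"
    using Cons.prems(1) ds(1) cs(2,3) by fastforce
  moreover have "set (concat (ds @ cs)) \<subseteq> set (concat (p # ps))" using ds(1) cs(3) by auto
  ultimately show ?case using cs(1,4) ds(2,3) by (intro exI[of _ "ds @ cs"]) auto
qed simp

text \<open>Bounds the marked entries lost in dropped tails: each list loses a remainder modulo
  \<open>l\<close>.\<close>

lemma sum_list_le_div:
  fixes f :: "'a \<Rightarrow> nat"
  assumes "1 \<le> l"
  shows "(\<Sum>p\<leftarrow>ps. f p) \<le> (\<Sum>p\<leftarrow>ps. f p div l) * l + length ps * (l - 1)"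
proof (induction ps)
  case (Cons p ps)
  have "f p mod l \<le> l - 1" using assms by (metis Suc_diff_1 less_Suc_eq_le mod_less_divisor zero_less_one order_less_le_trans)
  then have "f p \<le> f p div l * l + (l - 1)" using div_mult_mod_eq[of "f p" l] by linarith
  then have "f p + (\<Sum>p\<leftarrow>ps. f p) \<le>
      f p div l * l + (l - 1) + ((\<Sum>p\<leftarrow>ps. f p div l) * l + length ps * (l - 1))"
    using Cons.IH by linarith
  also have "\<dots> = (\<Sum>p\<leftarrow>p # ps. f p div l) * l + length (p # ps) * (l - 1)"
    by (simp add: add_mult_distrib)
  finally show ?case by simp
qed simp

section \<open>Connected sets of a symmetric relation\<close>

lemma conn_in_root:
  assumes "sym E" "\<And>x. x \<in> M \<Longrightarrow> (r, x) \<in> (E \<inter> M \<times> M)\<^sup>*"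
  shows "conn_in E M"
proof -
  \<comment> \<open>Paths from \<open>r\<close> can be reversed, so any two elements are joined
    through \<open>r\<close>.\<close>
  have "sym ((E \<inter> M \<times> M)\<^sup>*)" using assms(1) by (intro sym_rtrancl) (auto simp: sym_def)
  then show ?thesis unfolding conn_in_def using assms(2) by (meson rtrancl_trans symD)
qed

lemma walk_reaches:
  assumes "successively (\<lambda>x y. (x, y) \<in> E) (a # w)" "set (a # w) \<subseteq> M" "x \<in> set (a # w)"
  shows "(a, x) \<in> (E \<inter> M \<times> M)\<^sup>*"
  using assms
proof (induction w arbitrary: a)
  case (Cons b w)
  show ?case
  proof (cases "x = a")
    case False
    then have "(b, x) \<in> (E \<inter> M \<times> M)\<^sup>*" using Cons by (auto simp: successively_Cons)
    moreover have "(a, b) \<in> E \<inter> M \<times> M" using Cons.prems by auto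
    ultimately show ?thesis by (meson converse_rtrancl_into_rtrancl)
  qed simp
qed simp

lemma reachable_walk:
  assumes "(a, b) \<in> (E \<inter> M \<times> M)\<^sup>*" "a \<in> M"
  shows "\<exists>w. is_walk E {a} {b} w \<and> set w \<subseteq> M"
  using assms
proof (induction)
  case base
  then show ?case by (intro exI[of _ "[a]"]) (auto simp: is_walk_def)
next
  case (step y z)
  then obtain w where "is_walk E {a} {y} w" "set w \<subseteq> M" by blast
  then show ?case using step
    by (intro exI[of _ "w @ [z]"]) (auto simp: is_walk_def successively_append_iff)
qed

lemma conn_in_Un:
  assumes "sym E" "conn_in E M" "conn_in E N" "u \<in> M" "v \<in> N" "(u, v) \<in> E"
  shows "conn_in E (M \<union> N)"
proof (rule conn_in_root[OF assms(1), of _ u])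
  let ?R = "E \<inter> (M \<union> N) \<times> (M \<union> N)"
  have sub: "(E \<inter> M \<times> M)\<^sup>* \<subseteq> ?R\<^sup>*" "(E \<inter> N \<times> N)\<^sup>* \<subseteq> ?R\<^sup>*" by (intro rtrancl_mono; blast)+
  fix x assume "x \<in> M \<union> N"
  then show "(u, x) \<in> ?R\<^sup>*"
  proof
    assume "x \<in> M"
    then show ?thesis using assms sub by (auto simp: conn_in_def)
  next
    assume "x \<in> N"
    then have "(v, x) \<in> ?R\<^sup>*" using assms sub by (auto simp: conn_in_def)
    moreover have "(u, v) \<in> ?R" using assms by blast
    ultimately show ?thesis by (meson converse_rtrancl_into_rtrancl)
  qed
qed

text \<open>The form of a rooted model of the path on \<open>l\<close> vertices used with relations.
  Branch sets are nonempty because they meet \<open>S\<close>, and one orientation of each path edge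
  is enough when \<open>E\<close> is symmetric.\<close>

definition path_model :: "('v \<times> 'v) set \<Rightarrow> 'v set \<Rightarrow> 'v set \<Rightarrow> nat \<Rightarrow> (nat \<Rightarrow> 'v set) \<Rightarrow> bool" where
  "path_model E V S l B \<longleftrightarrow>
     (\<forall>i<l. B i \<subseteq> V \<and> conn_in E (B i) \<and> B i \<inter> S \<noteq> {}) \<and> disjoint_family_on B {..<l} \<and>
     (\<forall>i. Suc i < l \<longrightarrow> (\<exists>u\<in>B i. \<exists>v\<in>B (Suc i). (u, v) \<in> E))"

text \<open>Branch sets are added one at a time, each joined by an edge to the one before. This
  makes \<open>path_cover\<close> applicable to the vertex sets of models.\<close>

lemma conn_in_path_model:
  assumes "sym E" "path_model E V S l B"
  shows "conn_in E (\<Union>i<l. B i)"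
proof -
  have "conn_in E (\<Union>i<n. B i)" if "n \<le> l" for n
    using that
  proof (induction n)
    case (Suc n)
    show ?case
    proof (cases n)
      case 0
      then have "(\<Union>i<Suc n. B i) = B 0" by auto
      then show ?thesis using assms Suc 0 by (auto simp: path_model_def)
    next
      case (Suc m)
      then obtain u v where "u \<in> B m" "v \<in> B n" "(u, v) \<in> E"
        using assms Suc.prems unfolding path_model_def by (metis Suc_le_lessD)
      then have "conn_in E ((\<Union>i<n. B i) \<union> B n)"
        using assms Suc.IH Suc.prems Suc by (intro conn_in_Un[of _ _ _ u v]) (auto simp: path_model_def)
      then show ?thesis by (simp add: lessThan_Suc Un_commute)
    qed
  qed (simp add: conn_in_def)
  then show ?thesis by simp
qed

text \<open>The cutting has two levels: chunks with \<open>l\<close> starting points of legs to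
  \<open>S\<close> become models, and each is cut again into \<open>l\<close> pieces with a starting
  point each, which together with their legs become branch sets.\<close>

lemma linkage_path_models:
  assumes E: "sym E" "E \<subseteq> V \<times> V" and ps: "set (concat ps) \<subseteq> V" "distinct (concat ps)"
    "\<forall>p\<in>set ps. successively (\<lambda>x y. (x, y) \<in> E) p"
    and len: "length ps < k" and l: "1 \<le> l"
    and link: "has_linkage E (set (concat ps)) S (Suc ((2 * l - 1) * (k - 1)))"
  shows "\<exists>M. (\<forall>i<k. path_model E V S l (M i)) \<and> disjoint_family_on (\<lambda>i. \<Union>j<l. M i j) {..<k}"
proof -
  let ?A = "set (concat ps)" and ?R = "\<lambda>x y. (x, y) \<in> E"
  \<comment> \<open>Each walk is kept only from its last vertex in \<open>?A\<close> on, so the leg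
    \<open>d t\<close> leaves \<open>?A\<close> at \<open>t\<close> for good.\<close>
  obtain T d where T: "T \<subseteq> ?A" "card T = Suc ((2 * l - 1) * (k - 1))"
      "\<forall>t\<in>T. is_walk E {t} S (t # d t)" "\<forall>t\<in>T. set (d t) \<inter> ?A = {}"
      "disjoint_family_on (\<lambda>t. set (t # d t)) T"
    using link by (rule linkage_trim_start)
  obtain cs where cs: "length cs = (\<Sum>p\<leftarrow>ps. length (filter (\<lambda>x. x \<in> T) p) div l)" "distinct (concat cs)"
    "set (concat cs) \<subseteq> ?A" "\<forall>c\<in>set cs. successively ?R c \<and> l \<le> length (filter (\<lambda>x. x \<in> T) c)"
    using split_all_chunks[OF ps(2,3)] by blast
  have "(\<Sum>p\<leftarrow>ps. length (filter (\<lambda>x. x \<in> T) p)) = length (filter (\<lambda>x. x \<in> T) (concat ps))"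
    by (simp add: filter_concat length_concat comp_def)
  also have "\<dots> = card (set (filter (\<lambda>x. x \<in> T) (concat ps)))"
    using ps(2) by (metis distinct_card distinct_filter)
  also have "set (filter (\<lambda>x. x \<in> T) (concat ps)) = T" using T(1) by auto
  \<comment> \<open>Dropped tails lose at most \<open>(k - 1) * (l - 1)\<close> of the
    \<open>(2 * l - 1) * (k - 1) + 1\<close> starting points. More than \<open>(k - 1) * l\<close>
    remain, which forces at least \<open>k\<close> chunks.\<close>
  finally have "Suc ((2 * l - 1) * (k - 1)) \<le> length cs * l + length ps * (l - 1)"
    using sum_list_le_div[OF l, of "\<lambda>p. length (filter (\<lambda>x. x \<in> T) p)" ps] T(2) cs(1) by simp
  also have "\<dots> \<le> length cs * l + (k - 1) * (l - 1)" using len by (intro add_left_mono mult_le_mono1) linarith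
  finally have "(k - 1) * l < length cs * l" using l
    by (cases l; cases k) (auto simp: algebra_simps)
  then have "k - 1 < length cs" by simp
  then have k: "k \<le> length cs" by linarith
  \<comment> \<open>The legs \<open>d t\<close> avoid all the paths, so cutting a path into chunks and attaching the legs keeps
    disjoint chunks disjoint.\<close>
  define fan where "fan X = X \<union> (\<Union>t\<in>X \<inter> T. set (d t))" for X
  have fan_mono: "fan X \<subseteq> fan Y" if "X \<subseteq> Y" for X Y using that by (auto simp: fan_def)
  have fan_disj: "fan X \<inter> fan Y = {}" if "X \<subseteq> ?A" "Y \<subseteq> ?A" "X \<inter> Y = {}" for X Y
  proof -
    have "set (d s) \<inter> set (d t) = {}" if "s \<in> X \<inter> T" "t \<in> Y \<inter> T" for s t
    proof -
      have "set (s # d s) \<inter> set (t # d t) = {}"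
        using that \<open>X \<inter> Y = {}\<close> by (intro disjoint_family_onD[OF T(5)]) auto
      then show ?thesis by auto
    qed
    moreover have "set (d t) \<inter> X = {}" "set (d t) \<inter> Y = {}" if "t \<in> T" for t
      using T(4) that \<open>X \<subseteq> ?A\<close> \<open>Y \<subseteq> ?A\<close> by blast+
    ultimately show ?thesis using that(3) unfolding fan_def by blast
  qed
  have fan_V: "fan X \<subseteq> V" if "X \<subseteq> ?A" for X
  proof -
    have "set (d t) \<subseteq> V" if "t \<in> T" for t
    proof -
      have w: "successively ?R (t # d t)" using T(3) that by (auto simp: is_walk_def)
      \<comment> \<open>Plain reachability is enough: \<open>x\<close> is \<open>t\<close> itself or
        the second component of a pair in \<open>E\<close>, and both lie in
        \<open>V\<close>.\<close>
      have "(t, x) \<in> (E \<inter> UNIV \<times> UNIV)\<^sup>*" if "x \<in> set (d t)" for x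
        by (rule walk_reaches[OF w]) (use that in auto)
      then have "x \<in> V" if "x \<in> set (d t)" for x
        using that E(2) T(1) ps(1) \<open>t \<in> T\<close> by (metis Int_UNIV_right UNIV_Times_UNIV mem_Sigma_iff rtranclE subset_iff)
      then show ?thesis by blast
    qed
    then show ?thesis using that ps(1) unfolding fan_def by blast
  qed
  have fan_conn: "conn_in E (fan (set g))" if "successively ?R g" "g \<noteq> []" for g
  proof (rule conn_in_root[OF E(1), of _ "hd g"])
    fix x assume "x \<in> fan (set g)"
    have g: "(hd g, y) \<in> (E \<inter> fan (set g) \<times> fan (set g))\<^sup>*" if "y \<in> set g" for y
      using walk_reaches[of E "hd g" "tl g" "fan (set g)" y] that \<open>successively ?R g\<close> \<open>g \<noteq> []\<close>
      by (auto simp: fan_def)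
    show "(hd g, x) \<in> (E \<inter> fan (set g) \<times> fan (set g))\<^sup>*"
    proof (cases "x \<in> set g")
      case False
      then obtain t where t: "t \<in> set g" "t \<in> T" "x \<in> set (d t)"
        using \<open>x \<in> fan (set g)\<close> by (auto simp: fan_def)
      then have "(t, x) \<in> (E \<inter> fan (set g) \<times> fan (set g))\<^sup>*"
        using T(3) by (intro walk_reaches[of E t "d t"]) (auto simp: is_walk_def fan_def)
      then show ?thesis using g[OF t(1)] by simp
    qed (use g in auto)
  qed
  have "\<exists>B. path_model E V S l B \<and> (\<Union>j<l. B j) \<subseteq> fan (set c)" if c: "c \<in> set cs" for c
  proof -
    have c': "successively ?R c" "l \<le> length (filter (\<lambda>x. x \<in> T) c)" "distinct c" "set c \<subseteq> ?A"
      using cs c by (auto simp: distinct_concat_iff)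
    \<comment> \<open>With threshold 1, the chunk is cut into \<open>l\<close> pieces that each
      contain the start of a leg.\<close>
    obtain gs rest where gs: "c = concat gs @ rest" "length gs = l"
      "\<forall>g\<in>set gs. 1 \<le> length (filter (\<lambda>x. x \<in> T) g)"
      using split_chunks[of l 1 "\<lambda>x. x \<in> T" c] c'(2) by auto
    have T_g: "\<exists>t\<in>set g. t \<in> T" if "g \<in> set gs" for g
    proof -
      have "filter (\<lambda>x. x \<in> T) g \<noteq> []" using gs(3) that by fastforce
      then show ?thesis by (auto simp: filter_empty_conv)
    qed
    then have ne: "[] \<notin> set gs" by fastforce
    have succ: "successively ?R (concat gs)" using c'(1) gs(1) by (simp add: successively_append_iff)
    have sub: "set g \<subseteq> set c" if "g \<in> set gs" for g using gs(1) that by auto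
    define B where "B j = fan (set (gs ! j))" for j
    have "path_model E V S l B"
      unfolding path_model_def
    proof (intro conjI allI impI)
      fix j assume "j < l"
      then have g: "gs ! j \<in> set gs" using gs(2) by simp
      show "B j \<subseteq> V" unfolding B_def using sub[OF g] c'(4) by (intro fan_V) blast
      show "conn_in E (B j)" unfolding B_def
        using successively_concat_member[OF succ g] ne g by (intro fan_conn) auto
      obtain t where t: "t \<in> set (gs ! j)" "t \<in> T" using T_g[OF g] by blast
      then have "last (t # d t) \<in> S" using T(3) by (auto simp: is_walk_def)
      moreover have "last (t # d t) \<in> B j"
        using t last_in_set[of "t # d t"] by (auto simp: B_def fan_def simp del: last.simps)
      ultimately show "B j \<inter> S \<noteq> {}" by blast
    next
      have "B i \<inter> B j = {}" if "i < j" "j < l" for i j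
        unfolding B_def
      proof (rule fan_disj)
        show "set (gs ! i) \<inter> set (gs ! j) = {}"
          using distinct_concat_nth_disjoint[of gs i j] c'(3) gs(1,2) that by simp
        show "set (gs ! i) \<subseteq> ?A" "set (gs ! j) \<subseteq> ?A"
          using sub[of "gs ! i"] sub[of "gs ! j"] gs(2) that c'(4) by (auto simp del: set_concat)
      qed
      then show "disjoint_family_on B {..<l}"
        unfolding disjoint_family_on_def by (metis Int_commute lessThan_iff nat_neq_iff)
    next
      \<comment> \<open>Pieces are consecutive in \<open>c\<close>, so an edge of the path joins the
        last vertex of one to the first vertex of the next.\<close>
      fix i assume i: "Suc i < l"
      then have "gs ! i \<noteq> []" "gs ! Suc i \<noteq> []" using ne gs(2) by (metis nth_mem Suc_lessD)+
      then have "last (gs ! i) \<in> B i" "hd (gs ! Suc i) \<in> B (Suc i)"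
        by (auto simp: B_def fan_def)
      then show "\<exists>u\<in>B i. \<exists>v\<in>B (Suc i). (u, v) \<in> E"
        using successively_concat_adjacent[OF succ ne, of i] i gs(2) by blast
    qed
    moreover have "(\<Union>j<l. B j) \<subseteq> fan (set c)"
      using sub gs(2) by (auto simp: B_def dest!: subsetD[OF fan_mono[OF sub[OF nth_mem]], rotated])
    ultimately show ?thesis by blast
  qed
  then obtain B where B: "\<And>c. c \<in> set cs \<Longrightarrow> path_model E V S l (B c)"
    "\<And>c. c \<in> set cs \<Longrightarrow> (\<Union>j<l. B c j) \<subseteq> fan (set c)" by metis
  define M where "M i = B (cs ! i)" for i
  have "(\<Union>h<l. M i h) \<inter> (\<Union>h<l. M j h) = {}" if "i < j" "j < k" for i j
  proof -
    have *: "cs ! i \<in> set cs" "cs ! j \<in> set cs" using that k by auto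
    have "fan (set (cs ! i)) \<inter> fan (set (cs ! j)) = {}"
    proof (rule fan_disj)
      show "set (cs ! i) \<inter> set (cs ! j) = {}"
        using distinct_concat_nth_disjoint[OF cs(2)] that k by simp
    qed (use cs(3) * in auto)
    then show ?thesis using B(2)[OF *(1)] B(2)[OF *(2)] unfolding M_def by blast
  qed
  then have "disjoint_family_on (\<lambda>i. \<Union>h<l. M i h) {..<k}"
    unfolding disjoint_family_on_def by (metis Int_commute lessThan_iff nat_neq_iff)
  moreover have "\<forall>i<k. path_model E V S l (M i)" using B(1) k by (auto simp: M_def)
  ultimately show ?thesis by blast
qed

lemma path_model_hitting_set:
  assumes fin: "finite V" and E: "E \<subseteq> V \<times> V" "sym E" and S: "S \<subseteq> V" and l: "1 \<le> l" and k: "1 \<le> k"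
    and no: "\<nexists>M. (\<forall>i<k. path_model E V S l (M i)) \<and> disjoint_family_on (\<lambda>i. \<Union>j<l. M i j) {..<k}"
  shows "\<exists>X\<subseteq>V. card X \<le> (2 * l - 1) * (k - 1) \<and>
    (\<forall>B. path_model E V S l B \<longrightarrow> (\<Union>j<l. B j) \<inter> X \<noteq> {})"
proof -
  define \<M> where "\<M> = {\<Union>j<l. B j |B. path_model E V S l B}"
  have V: "M \<subseteq> V" if "M \<in> \<M>" for M using that by (auto simp: \<M>_def path_model_def)
  then have finM: "finite \<M>" using fin by (meson PowI finite_Pow_iff finite_subset subsetI)
  have meets: "M \<inter> S \<noteq> {}" if "M \<in> \<M>" for M
  proof -
    obtain B where B: "M = (\<Union>j<l. B j)" "path_model E V S l B" using \<open>M \<in> \<M>\<close> by (auto simp: \<M>_def)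
    then have "B 0 \<inter> S \<noteq> {}" "B 0 \<subseteq> M" using l by (auto simp: path_model_def)
    then show ?thesis by blast
  qed
  then have ne: "{} \<notin> \<M>" by blast
  have conn: "conn_in E M" if "M \<in> \<M>" for M
    using that conn_in_path_model[OF E(2)] by (auto simp: \<M>_def)
  \<comment> \<open>Otherwise \<open>k\<close> disjoint members, indexed by a bijection, would be
    the vertex sets of \<open>k\<close> disjoint models.\<close>
  have pack: "packing_number \<M> V < k"
  proof (rule ccontr)
    assume *: "\<not> ?thesis"
    obtain \<F> where F: "\<F> \<subseteq> \<M>" "\<Union>\<F> \<subseteq> V" "disjoint \<F>" "card \<F> = packing_number \<M> V"
      by (rule packing_number_attained[OF finM])
    then have "k \<le> card \<F>" using * by simp
    then obtain \<G> where G: "\<G> \<subseteq> \<F>" "card \<G> = k" "finite \<G>" by (rule obtain_subset_with_card_n)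
    then obtain f where f: "bij_betw f {..<k} \<G>" by (metis ex_bij_betw_nat_finite lessThan_atLeast0)
    have "\<exists>B. path_model E V S l B \<and> f i = (\<Union>j<l. B j)" if "i < k" for i
    proof -
      have "f i \<in> \<M>" using f that F G by (meson bij_betwE lessThan_iff subsetD)
      then show ?thesis by (auto simp: \<M>_def)
    qed
    then obtain M where M: "\<And>i. i < k \<Longrightarrow> path_model E V S l (M i)" "\<And>i. i < k \<Longrightarrow> f i = (\<Union>j<l. M i j)" by metis
    have "f i \<inter> f j = {}" if "i < k" "j < k" "i \<noteq> j" for i j
    proof -
      have "f i \<in> \<F>" "f j \<in> \<F>" "f i \<noteq> f j"
        using f G(1) that by (auto simp: bij_betw_def inj_on_def)
      then show ?thesis using F(3) by (auto simp: disjoint_def)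
    qed
    then have "disjoint_family_on (\<lambda>i. \<Union>j<l. M i j) {..<k}"
      unfolding disjoint_family_on_def using M(2) by simp
    then show False using no M(1) by blast
  qed
  \<comment> \<open>With \<open>V\<close> as start set, the reachability hypothesis of
    \<open>path_cover\<close> holds by paths of length 0.\<close>
  have "\<exists>u\<in>V \<inter> V. \<exists>m\<in>M. (u, m) \<in> (E \<inter> V \<times> V)\<^sup>*" if M: "M \<in> \<M>" "M \<subseteq> V" for M
    using meets[OF M(1)] M(2) by blast
  then obtain ps where ps: "length ps \<le> packing_number \<M> V" "distinct (concat ps)" "set (concat ps) \<subseteq> V"
    "\<forall>p\<in>set ps. p \<noteq> [] \<and> successively (\<lambda>x y. (x, y) \<in> E) p"
    "\<forall>M\<in>\<M>. M \<subseteq> V \<longrightarrow> M \<inter> set (concat ps) \<noteq> {}"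
    using path_cover[OF fin finM ne conn, of V] by blast
  let ?A = "set (concat ps)" and ?n = "(2 * l - 1) * (k - 1)"
  have no_link: "\<not> has_linkage E ?A S (Suc ?n)"
    using linkage_path_models[OF E(2,1) ps(3,2), of k l S] ps(1,4) pack l no by auto
  have "finite E" using E(1) fin by (meson finite_SigmaI finite_subset)
  from menger[OF this List.finite_set finite_subset[OF S fin]] no_link
  have "\<exists>X. finite X \<and> separates E ?A S X \<and> \<not> Suc ?n \<le> card X" by metis
  then obtain X where X: "finite X" "separates E ?A S X" "card X \<le> ?n"
    by (metis not_less_eq_eq)
  \<comment> \<open>The separator from Menger's theorem may contain elements outside
    \<open>V\<close>, hence the intersection.\<close>
  show ?thesis
  proof (intro exI[of _ "X \<inter> V"] conjI allI impI)
    have "card (X \<inter> V) \<le> card X" using X(1) by (intro card_mono) auto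
    then show "card (X \<inter> V) \<le> ?n" using X(3) by simp
    fix B assume "path_model E V S l B"
    define U where "U = (\<Union>j<l. B j)"
    have U: "U \<in> \<M>" using \<open>path_model E V S l B\<close> by (auto simp: \<M>_def U_def)
    have "U \<inter> ?A \<noteq> {}" using ps(5) U V[OF U] by simp
    then obtain a where a: "a \<in> U" "a \<in> ?A" by blast
    obtain s where s: "s \<in> U" "s \<in> S" using meets[OF U] by blast
    have "(a, s) \<in> (E \<inter> U \<times> U)\<^sup>*" using conn[OF U] a s unfolding conn_in_def by blast
    then obtain w where w: "is_walk E {a} {s} w" "set w \<subseteq> U" using reachable_walk a(1) by metis
    then have "is_walk E ?A S w" using a s by (auto simp: is_walk_def)
    then have "set w \<inter> X \<noteq> {}" using X(2) unfolding separates_def by blast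
    then show "(\<Union>j<l. B j) \<inter> (X \<inter> V) \<noteq> {}" using w(2) V[OF U] unfolding U_def by blast
  qed auto
qed

section \<open>Rooted models of path graphs\<close>

lemma arcs_ends_induce: "arcs_ends (G \<restriction> B) = arcs_ends G \<inter> B \<times> B"
  by (auto simp: arcs_ends_conv)

text \<open>\<open>rtrancl_on B\<close> is reflexive only on \<open>B\<close>; once the start lies
  in \<open>B\<close>, the two closures agree.\<close>

lemma rtrancl_on_restrict:
  assumes "u \<in> B"
  shows "(u, v) \<in> rtrancl_on B (E \<inter> B \<times> B) \<longleftrightarrow> (u, v) \<in> (E \<inter> B \<times> B)\<^sup>*"
proof
  assume "(u, v) \<in> rtrancl_on B (E \<inter> B \<times> B)"
  then show "(u, v) \<in> (E \<inter> B \<times> B)\<^sup>*"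
    by induction (auto intro: converse_rtrancl_into_rtrancl)
next
  assume "(u, v) \<in> (E \<inter> B \<times> B)\<^sup>*"
  then show "(u, v) \<in> rtrancl_on B (E \<inter> B \<times> B)"
    by induction (use assms in \<open>auto intro: rtrancl_on_into_rtrancl_on\<close>)
qed

text \<open>\<open>connected\<close> refers to the symmetric closure, which changes nothing when
  \<open>G\<close> is symmetric, and demands at least one vertex.\<close>

lemma connected_induce_iff:
  assumes "symmetric G"
  shows "connected (G \<restriction> B) \<longleftrightarrow> B \<noteq> {} \<and> conn_in (arcs_ends G) B"
proof -
  have "(arcs_ends (G \<restriction> B))\<^sup>s = arcs_ends G \<inter> B \<times> B"
    using assms by (auto simp: arcs_ends_induce symcl_def symmetric_def dest: symD)
  then show ?thesis
    using rtrancl_on_restrict[of _ B _ "arcs_ends G"] by (simp add: connected_conv conn_in_def)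
qed

lemma arcs_ends_path_graph:
  "(i, j) \<in> arcs_ends (with_proj (path_graph l)) \<longleftrightarrow> i < l \<and> j < l \<and> (j = Suc i \<or> i = Suc j)"
  by (simp add: path_graph_def)

lemma verts_path_graph: "verts (with_proj (path_graph l)) = {..<l}"
  by (simp add: path_graph_def)

text \<open>\<open>path_graph\<close> contains both orientations of each edge, while
  \<open>path_model\<close> asks for one; symmetry of \<open>G\<close> supplies the other.\<close>

lemma is_rooted_model_path_graph_iff:
  assumes "symmetric G"
  shows "is_rooted_model S (path_graph l) G B \<longleftrightarrow> path_model (arcs_ends G) (verts G) S l B"
proof -
  have "(\<forall>i j. i < l \<and> j < l \<and> (j = Suc i \<or> i = Suc j) \<longrightarrow> (\<exists>u\<in>B i. \<exists>v\<in>B j. u \<rightarrow>\<^bsub>G\<^esub> v)) \<longleftrightarrow>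
      (\<forall>i. Suc i < l \<longrightarrow> (\<exists>u\<in>B i. \<exists>v\<in>B (Suc i). u \<rightarrow>\<^bsub>G\<^esub> v))" (is "?L \<longleftrightarrow> ?R")
  proof
    assume L: ?L
    show ?R using L[rule_format, of i "Suc i" for i] by simp
  next
    assume R: ?R
    have "\<exists>u\<in>B i. \<exists>v\<in>B j. u \<rightarrow>\<^bsub>G\<^esub> v" if "i < l" "j < l" "j = Suc i \<or> i = Suc j" for i j
      using that(3)
    proof
      assume "j = Suc i"
      then show ?thesis using R that by blast
    next
      assume "i = Suc j"
      then obtain u v where "u \<in> B j" "v \<in> B i" "u \<rightarrow>\<^bsub>G\<^esub> v" using R \<open>i < l\<close> by metis
      then show ?thesis using arcs_ends_symmetric[OF assms] by blast
    qed
    then show ?L by blast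
  qed
  then show ?thesis
    unfolding is_rooted_model_def is_model_def path_model_def verts_path_graph arcs_ends_path_graph
      connected_induce_iff[OF assms]
    by blast
qed

text \<open>Branch sets in the smaller graph avoid \<open>X\<close>, so they induce the same
  subgraphs there as in \<open>G\<close>.\<close>

lemma is_rooted_model_delete_verts:
  assumes "is_rooted_model S H (delete_verts G X) B"
  shows "is_rooted_model S H G B" "model_verts H B \<inter> X = {}"
proof -
  have sub: "B x \<subseteq> verts G - X" if "x \<in> verts H" for x
    using assms that by (auto simp: is_rooted_model_def is_model_def delete_verts_def)
  have "delete_verts G X \<restriction> B x = G \<restriction> B x" if "x \<in> verts H" for x
    using sub[OF that] unfolding delete_verts_def induce_subgraph_def by auto
  moreover have "u \<rightarrow>\<^bsub>G\<^esub> v" if "u \<rightarrow>\<^bsub>delete_verts G X\<^esub> v" for u v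
    using that unfolding delete_verts_def by (rule dominates_induce_subgraphD)
  ultimately show "is_rooted_model S H G B"
    using assms sub unfolding is_rooted_model_def is_model_def by (metis Diff_subset order_trans)
  show "model_verts H B \<inter> X = {}" using sub by (auto simp: model_verts_def)
qed

theorem theorem21:
  fixes G :: "('a, 'b) pre_digraph" and S :: "'a set" and k l :: nat
  assumes "graph G"
    and "S \<subseteq> verts G"
    and "k \<ge> 1"
    and "l \<ge> 2"
    and "\<not> has_disjoint_rooted_models k S (path_graph l) G"
  shows "\<exists>X \<subseteq> verts G. card X \<le> (l\<^sup>2 - 1) * (k - 1) \<and>
           \<not> (\<exists>B. is_rooted_model S (path_graph l) (delete_verts G X) B)"
proof -
  interpret graph G by fact
  let ?E = "arcs_ends G" and ?V = "verts G"
  note sym = sym_arcs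
  note model_iff = is_rooted_model_path_graph_iff[OF sym]
  have "?E \<subseteq> ?V \<times> ?V" by (auto simp: arcs_ends_conv)
  moreover have "sym ?E" using sym by (simp add: symmetric_def)
  moreover have "\<nexists>M. (\<forall>i<k. path_model ?E ?V S l (M i)) \<and> disjoint_family_on (\<lambda>i. \<Union>j<l. M i j) {..<k}"
    using assms(5) unfolding has_disjoint_rooted_models_def model_iff model_verts_def verts_path_graph .
  ultimately obtain X where X: "X \<subseteq> ?V" "card X \<le> (2 * l - 1) * (k - 1)"
      "\<forall>B. path_model ?E ?V S l B \<longrightarrow> (\<Union>j<l. B j) \<inter> X \<noteq> {}"
    using path_model_hitting_set[of ?V ?E S l k] assms(2-4) by auto
  have "2 * l \<le> l\<^sup>2" using assms(4) by (simp add: power2_eq_square)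
  then have "(2 * l - 1) * (k - 1) \<le> (l\<^sup>2 - 1) * (k - 1)" by (intro mult_le_mono1) linarith
  then have "card X \<le> (l\<^sup>2 - 1) * (k - 1)" using X(2) by linarith
  moreover have "\<not> is_rooted_model S (path_graph l) (delete_verts G X) B" for B
  proof
    assume "is_rooted_model S (path_graph l) (delete_verts G X) B"
    from is_rooted_model_delete_verts[OF this] X(3) show False
      unfolding model_iff model_verts_def verts_path_graph by blast
  qed
  ultimately show ?thesis using X(1) by blast
qed

end
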